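(* If $$G = \bigvee_{i=1}^{l} \Big( \bigcup_{j=1}^{k} K_{a_{i,j}} \Big),$$ where $k \geq 2$ and the $a_{i,j}$ ($i = 1,2,\dots,l$, $j = 1,2,\dots,k$) are positive integers, then $q(G) = 2$ and $MB(G) = k$.
   Context: All graphs are finite and simple. For a graph $G$ on $n$ vertices, $\mathcal{S}(G)$ is the set of real symmetric $n\times n$ matrices (indexed by the vertices) such that for distinct vertices $u, v$ the $(u,v)$ entry is nonzero if and only if $uv$ is an edge of $G$; the diagonal entries are arbitrary. $q(A)$ is the number of distinct eigenvalues of a symmetric matrix $A$, and $q(G)=\min\{q(A): A\in\mathcal{S}(G)\}$. A graph $G$ on $n$ vertices achieves the multiplicity bipartition $[n-m,m]$, where $1\le m\leq\lfloor n/2\rfloor$, if some $A\in\mathcal{S}(G)$ has exactly two distinct eigenvalues, with multiplicities $n-m$ and $m$. For a graph $G$ that admits a matrix in $\mathcal{S}(G)$ with exactly two distinct eigenvalues, $MB(G)$ is the least integer $m\leq \lfloor n/2\rfloor$ such that $G$ achieves $[n-m,m]$. $\bigvee$ denotes the join of graphs (disjoint union plus all edges between different factors), $\bigcup$ denotes disjoint union, and $K_a$ is the complete graph on $a$ vertices.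
   Formalization: Assumes l ≥ 1 and, when l = 1, that every a_{1,j} ≥ 2. With l = 1 and some a_{1,j} = 1 the claim fails: for K_2 ∪ K_1 (k = 2), MB(G) = 1, and if all a_{1,j} = 1 then q(G) = 1. *)

theory Defs
  imports "Graph_Theory.Pair_Digraph" "Jordan_Normal_Form.Spectral_Radius"
begin

text \<open>A finite simple graph is a \<^locale>\<open>pair_graph\<close>: a finite symmetric loopless digraph
  whose arcs are ordered pairs of vertices, so an edge \<open>uv\<close> is the pair of arcs
  \<open>(u,v)\<close>, \<open>(v,u)\<close>.\<close>

definition complete_graph :: "nat \<Rightarrow> nat pair_pre_digraph" where
  "complete_graph n = \<lparr> pverts = {..<n}, parcs = {(u, v). u < n \<and> v < n \<and> u \<noteq> v} \<rparr>"

text \<open>The vertices of the factors are tagged by the index of the factor, which makes the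
  union disjoint.\<close>

definition graph_union :: "'i set \<Rightarrow> ('i \<Rightarrow> 'v pair_pre_digraph) \<Rightarrow> ('i \<times> 'v) pair_pre_digraph" where
  "graph_union I H = \<lparr> pverts = (SIGMA i:I. pverts (H i)),
     parcs = {((i, u), (i, v)) | i u v. i \<in> I \<and> (u, v) \<in> parcs (H i)} \<rparr>"

definition graph_join :: "'i set \<Rightarrow> ('i \<Rightarrow> 'v pair_pre_digraph) \<Rightarrow> ('i \<times> 'v) pair_pre_digraph" where
  "graph_join I H = \<lparr> pverts = pverts (graph_union I H),
     parcs = parcs (graph_union I H) \<union>
       {((i, u), (j, v)) | i j u v. i \<in> I \<and> j \<in> I \<and> i \<noteq> j \<and>
          u \<in> pverts (H i) \<and> v \<in> pverts (H j)} \<rparr>"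

lemma pair_graph_iff:
  "pair_graph G \<longleftrightarrow> finite (pverts G) \<and> parcs G \<subseteq> pverts G \<times> pverts G \<and>
     sym (parcs G) \<and> irrefl (parcs G)"
proof
  assume "pair_graph G"
  then interpret pair_graph G .
  show "finite (pverts G) \<and> parcs G \<subseteq> pverts G \<times> pverts G \<and> sym (parcs G) \<and> irrefl (parcs G)"
    using pair_finite_verts pair_sym_arcs in_arcsD1 in_arcsD2 pair_no_loops
    by (fastforce simp: symmetric_def irrefl_def)
next
  assume *: "finite (pverts G) \<and> parcs G \<subseteq> pverts G \<times> pverts G \<and>
     sym (parcs G) \<and> irrefl (parcs G)"
  then have "finite (parcs G)"
    by (meson finite_SigmaI finite_subset)
  with * show "pair_graph G"
    by unfold_locales (auto simp: symmetric_def irrefl_def)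
qed

lemma pair_graph_complete_graph: "pair_graph (complete_graph n)"
  by (auto simp: pair_graph_iff complete_graph_def sym_def irrefl_def)

lemma pair_graph_graph_union:
  assumes "finite I" "\<And>i. i \<in> I \<Longrightarrow> pair_graph (H i)"
  shows "pair_graph (graph_union I H)"
  using assms unfolding pair_graph_iff graph_union_def sym_def irrefl_def by (auto; blast)

lemma pair_graph_graph_join:
  assumes "finite I" "\<And>i. i \<in> I \<Longrightarrow> pair_graph (H i)"
  shows "pair_graph (graph_join I H)"
  using assms unfolding pair_graph_iff graph_join_def graph_union_def sym_def irrefl_def by (auto; blast)

text \<open>Matrices have index set \<open>{0..<n}\<close>, so a matrix indexed by the vertices is one whose rows and
  columns are labelled by some enumeration \<open>f\<close> of the vertices. Relabelling replaces a matrix by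
  a permutation-similar one, which has the same eigenvalues with the same multiplicities.\<close>

definition graph_matrices :: "'v pair_pre_digraph \<Rightarrow> real mat set" (\<open>\<S>\<close>) where
  "\<S> G = {A. let n = card (pverts G) in
     A \<in> carrier_mat n n \<and> transpose_mat A = A \<and>
     (\<exists>f. bij_betw f {..<n} (pverts G) \<and>
        (\<forall>i<n. \<forall>j<n. i \<noteq> j \<longrightarrow> (A $$ (i, j) \<noteq> 0 \<longleftrightarrow> (f i, f j) \<in> parcs G)))}"

definition q_mat :: "real mat \<Rightarrow> nat" where
  "q_mat A = card (spectrum A)"

definition q :: "'v pair_pre_digraph \<Rightarrow> nat" where
  "q G = (LEAST d. \<exists>A \<in> \<S> G. q_mat A = d)"

text \<open>Multiplicities are algebraic; for real symmetric matrices they agree with the geometric ones.\<close>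

definition achieves_bipartition :: "'v pair_pre_digraph \<Rightarrow> nat \<Rightarrow> bool" where
  "achieves_bipartition G m \<longleftrightarrow>
     1 \<le> m \<and> m \<le> card (pverts G) div 2 \<and>
     (\<exists>A \<in> \<S> G. \<exists>\<mu> \<nu>. \<mu> \<noteq> \<nu> \<and> spectrum A = {\<mu>, \<nu>} \<and>
        order \<mu> (char_poly A) = card (pverts G) - m \<and> order \<nu> (char_poly A) = m)"

definition MB :: "'v pair_pre_digraph \<Rightarrow> nat" where
  "MB G = (LEAST m. achieves_bipartition G m)"

end

theory Submission
  imports Defs
begin

text \<open>Lower bound: if \<open>A \<in> \<S> G\<close> has the eigenvalues \<open>\<mu>\<close>, \<open>\<nu>\<close> and \<open>\<nu>\<close> has multiplicity \<open>m\<close>, then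
  \<open>E = (A - \<mu> I) / (\<nu> - \<mu>)\<close> is an orthogonal projection of trace \<open>m\<close>. One vertex from each clique of the
  first factor gives \<open>k\<close> independent, non-isolated vertices \<open>u\<close>; their columns \<open>E e\<^sub>u\<close> are nonzero and
  pairwise orthogonal vectors in the range of \<open>E\<close>, so \<open>k \<le> m\<close>.

  Upper bound: choose orthogonal \<open>k \<times> k\<close> matrices \<open>Q\<^sub>1, \<dots>, Q\<^sub>l\<close> such that no row of \<open>Q\<^sub>i\<close> is orthogonal
  to a row of \<open>Q\<^sub>i'\<close> for \<open>i \<noteq> i'\<close>. Assigning to each vertex of the \<open>j\<close>-th clique of the \<open>i\<close>-th factor the \<open>j\<close>-th
  row of \<open>Q\<^sub>i\<close>, divided by \<open>sqrt (l * a i j)\<close>, gives the rows of a matrix \<open>B\<close> with orthonormal columns,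
  and \<open>B B\<^sup>T \<in> \<S> G\<close> has the eigenvalue 1 with multiplicity \<open>k\<close> and 0 otherwise.\<close>

section \<open>Diagonalization of real symmetric matrices\<close>

text \<open>For an eigenvector \<open>v\<close>, moving the symmetric matrix across the product of
  \<open>v\<close> with its conjugate evaluates the same number with factor \<open>z\<close> and
  with factor \<open>cnj z\<close>; that product is nonzero.\<close>

lemma real_symmetric_eigenvalue_real:
  fixes A :: "real mat"
  assumes A: "A \<in> carrier_mat n n" and sym: "transpose_mat A = A"
    and ev: "eigenvalue (map_mat complex_of_real A) z"
  shows "z \<in> \<real>"
proof -
  let ?A = "map_mat complex_of_real A"
  have cA: "?A \<in> carrier_mat n n" using A by simp
  from ev obtain v where v: "v \<in> carrier_vec n" "v \<noteq> 0\<^sub>v n" and Av: "?A *\<^sub>v v = z \<cdot>\<^sub>v v"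
    using A by (auto simp: eigenvalue_def eigenvector_def)
  have symA: "transpose_mat ?A = ?A"
  proof (rule eq_matI)
    fix i j assume "i < dim_row ?A" "j < dim_col ?A"
    then show "transpose_mat ?A $$ (i, j) = ?A $$ (i, j)"
      using A arg_cong[OF sym, of "\<lambda>M. M $$ (i, j)"] by simp
  qed (use A in auto)
  have conj_Av: "?A *\<^sub>v conjugate v = cnj z \<cdot>\<^sub>v conjugate v"
  proof -
    have "?A *\<^sub>v conjugate v = conjugate (?A *\<^sub>v v)"
      using A v by (intro eq_vecI) (auto simp: scalar_prod_def conjugate_complex_def)
    then show ?thesis
      by (simp add: Av conjugate_smult_vec conjugate_complex_def)
  qed
  have "z * (v \<bullet> conjugate v) = (transpose_mat ?A *\<^sub>v v) \<bullet> conjugate v"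
    using v by (simp add: symA Av)
  also have "\<dots> = v \<bullet> (?A *\<^sub>v conjugate v)"
    using transpose_vec_mult_scalar[OF cA, of "conjugate v" v] v by simp
  also have "\<dots> = cnj z * (v \<bullet> conjugate v)"
    using v by (simp add: conj_Av)
  finally have "z = cnj z"
    using conjugate_square_eq_0_vec[OF v(1)] v(2) by simp
  then show ?thesis
    by (metis Reals_cnj_iff)
qed

text \<open>The complex factorization has only real roots, so it is the image of a real product, and
  the coefficientwise embedding is injective.\<close>

lemma real_symmetric_char_poly_splits:
  fixes A :: "real mat"
  assumes A: "A \<in> carrier_mat n n" and sym: "transpose_mat A = A"
  obtains es where "char_poly A = (\<Prod>e\<leftarrow>es. [:- e, 1:])"
proof -
  interpret of_real_poly: map_poly_inj_idom_hom complex_of_real ..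
  let ?A = "map_mat complex_of_real A"
  have cA: "?A \<in> carrier_mat n n" using A by simp
  from char_poly_factorized[OF cA] obtain as where as: "char_poly ?A = (\<Prod>a\<leftarrow>as. [:- a, 1:])"
    by auto
  have real: "a \<in> \<real>" if "a \<in> set as" for a
  proof -
    have "poly (char_poly ?A) a = 0"
      unfolding as poly_prod_list using that by (auto simp: prod_list_zero_iff)
    then show ?thesis
      using real_symmetric_eigenvalue_real[OF A sym] eigenvalue_root_char_poly[OF cA] by blast
  qed
  have "map_poly complex_of_real (char_poly A) = (\<Prod>a\<leftarrow>as. [:- a, 1:])"
    using of_real_hom.char_poly_hom[OF A] as by metis
  also have "\<dots> = map_poly complex_of_real (\<Prod>e\<leftarrow>map Re as. [:- e, 1:])"
    using real by (induction as) (auto simp: of_real_poly.hom_mult simp del: mult_pCons_left)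
  finally have "char_poly A = (\<Prod>e\<leftarrow>map Re as. [:- e, 1:])"
    using of_real_poly.injectivity by blast
  then show thesis by (rule that)
qed

text \<open>Such entries lie on the superdiagonal inside a single Jordan block, where the diagonal
  is constant. Diagonality thus reduces to the vanishing of the superdiagonal.\<close>

lemma jordan_matrix_off_diagonal:
  assumes "i < sum_list (map fst n_as)" "j < sum_list (map fst n_as)" "i \<noteq> j"
    and "jordan_matrix n_as $$ (i, j) \<noteq> 0"
  shows "j = Suc i" "jordan_matrix n_as $$ (j, j) = jordan_matrix n_as $$ (i, i)"
proof -
  have "j = Suc i \<and> jordan_matrix n_as $$ (j, j) = jordan_matrix n_as $$ (i, i)"
    using assms
  proof (induction n_as arbitrary: i j)
    case (Cons na n_as)
    obtain m a where na: "na = (m, a)" by force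
    let ?J = "jordan_matrix n_as" and ?s = "sum_list (map fst n_as)"
    have J: "jordan_matrix (na # n_as) =
        four_block_mat (jordan_block m a) (0\<^sub>m m ?s) (0\<^sub>m ?s m) ?J"
      using jordan_matrix_dim[of n_as]
      by (simp add: jordan_matrix_def na Let_def)
    have ij: "i < m + ?s" "j < m + ?s" using Cons.prems na by auto
    consider "i < m" "j < m" | "i < m" "\<not> j < m" | "\<not> i < m" "j < m" | "\<not> i < m" "\<not> j < m"
      by blast
    then show ?case
    proof cases
      case 4
      then have "j - m = Suc (i - m) \<and> ?J $$ (j - m, j - m) = ?J $$ (i - m, i - m)"
        using Cons.prems ij by (intro Cons.IH) (auto simp: J)
      then show ?thesis using 4 ij by (auto simp: J)
    qed (use Cons.prems ij in \<open>auto simp: J split: if_splits\<close>)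
  qed simp
  then show "j = Suc i" "jordan_matrix n_as $$ (j, j) = jordan_matrix n_as $$ (i, i)"
    by auto
qed

text \<open>A Jordan block of size at least two would give a vector \<open>p\<close> which is both in the kernel and
  in the range of \<open>A - e I\<close>; as \<open>A\<close> is symmetric, \<open>p\<close> is then orthogonal to itself.\<close>

lemma real_symmetric_diagonalizable:
  fixes A :: "real mat"
  assumes A: "A \<in> carrier_mat n n" and sym: "transpose_mat A = A"
  obtains d P Q where "similar_mat_wit A (mat_diag n d) P Q"
proof -
  obtain es where "char_poly A = (\<Prod>e\<leftarrow>es. [:- e, 1:])"
    using real_symmetric_char_poly_splits[OF A sym] .
  from jordan_nf_exists[OF A this] obtain n_as where "jordan_nf A n_as" ..
  then obtain P Q where wit: "similar_mat_wit A (jordan_matrix n_as) P Q"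
    by (auto simp: jordan_nf_def similar_mat_def)
  let ?J = "jordan_matrix n_as"
  note w = similar_mat_witD2[OF A wit]
  have dim: "sum_list (map fst n_as) = n"
    using w(5) by (metis carrier_matD(1) jordan_matrix_dim(1))
  have AP: "A * P = P * ?J"
  proof -
    have "A * P = P * ?J * (Q * P)"
      using w assoc_mult_mat[of "P * ?J" n n Q n P n] by simp
    then show ?thesis using w right_mult_one_mat[of "P * ?J" n n] by simp
  qed
  \<comment> \<open>Strong induction: the earlier superdiagonal entries vanish, so column
    \<open>i\<close> of the Jordan matrix is purely diagonal and column \<open>i\<close> of
    \<open>P\<close> satisfies the eigenvector equation.\<close>
  have "?J $$ (i, Suc i) = 0" if "Suc i < n" for i
    using that
  proof (induction i rule: less_induct)
    case (less i)
    show ?case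
    proof (rule ccontr)
      assume nz: "?J $$ (i, Suc i) \<noteq> 0"
      let ?e = "?J $$ (i, i)" and ?t = "?J $$ (i, Suc i)"
      have e: "?J $$ (Suc i, Suc i) = ?e"
        using jordan_matrix_off_diagonal(2)[of i n_as "Suc i"] nz less.prems dim by simp
      have offi: "?J $$ (r, i) = 0" if "r < n" "r \<noteq> i" for r
        using jordan_matrix_off_diagonal(1)[of r n_as i] less that dim by fastforce
      have offs: "?J $$ (r, Suc i) = 0" if "r < n" "r \<noteq> i" "r \<noteq> Suc i" for r
        using jordan_matrix_off_diagonal(1)[of r n_as "Suc i"] that dim less.prems by fastforce
      define p p' where "p = col P i" and "p' = col P (Suc i)"
      have pc: "p \<in> carrier_vec n" "p' \<in> carrier_vec n"
        using w by (auto simp: p_def p'_def)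
      have Ap: "A *\<^sub>v p = ?e \<cdot>\<^sub>v p"
      proof -
        have "A *\<^sub>v p = col (P * ?J) i"
          using AP w less.prems by (metis Suc_lessD col_mult2 p_def)
        also have "\<dots> = ?e \<cdot>\<^sub>v p"
        proof (rule eq_vecI)
          fix a assume a: "a < dim_vec (?e \<cdot>\<^sub>v p)"
          have "col (P * ?J) i $ a = (\<Sum>r\<in>{0..<n}. P $$ (a, r) * ?J $$ (r, i))"
            using w a less.prems dim pc by (auto simp: scalar_prod_def)
          also have "\<dots> = (\<Sum>r\<in>{i}. P $$ (a, r) * ?J $$ (r, i))"
            using less.prems by (intro sum.mono_neutral_right) (auto simp: offi)
          finally show "col (P * ?J) i $ a = (?e \<cdot>\<^sub>v p) $ a"
            using a w less.prems pc by (auto simp: p_def)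
        qed (use w pc in auto)
        finally show ?thesis .
      qed
      have Ap': "A *\<^sub>v p' = ?e \<cdot>\<^sub>v p' + ?t \<cdot>\<^sub>v p"
      proof -
        have "A *\<^sub>v p' = col (P * ?J) (Suc i)"
          using AP w less.prems by (metis col_mult2 p'_def)
        also have "\<dots> = ?e \<cdot>\<^sub>v p' + ?t \<cdot>\<^sub>v p"
        proof (rule eq_vecI)
          fix a assume a: "a < dim_vec (?e \<cdot>\<^sub>v p' + ?t \<cdot>\<^sub>v p)"
          have "col (P * ?J) (Suc i) $ a = (\<Sum>r\<in>{0..<n}. P $$ (a, r) * ?J $$ (r, Suc i))"
            using w a less.prems dim pc by (auto simp: scalar_prod_def)
          also have "\<dots> = (\<Sum>r\<in>{i, Suc i}. P $$ (a, r) * ?J $$ (r, Suc i))"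
            using less.prems by (intro sum.mono_neutral_right) (auto simp: offs)
          finally show "col (P * ?J) (Suc i) $ a = (?e \<cdot>\<^sub>v p' + ?t \<cdot>\<^sub>v p) $ a"
            using a w less.prems pc e by (auto simp: p_def p'_def)
        qed (use w pc in auto)
        finally show ?thesis .
      qed
      have "(A *\<^sub>v p) \<bullet> p' = p \<bullet> (A *\<^sub>v p')"
        using transpose_vec_mult_scalar[OF A pc(2) pc(1)] sym by simp
      then have "?t * (p \<bullet> p) = 0"
        using pc by (simp add: Ap Ap' scalar_prod_add_distrib[of _ n])
      \<comment> \<open>A zero column of \<open>P\<close> contradicts \<open>Q * P\<close> being the
        identity at position \<open>(i, i)\<close>.\<close>
      then have "p = 0\<^sub>v n"
        using nz conjugate_square_eq_0_vec[OF pc(1)] by simp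
      moreover have "(Q * P) $$ (i, i) = 1"
        using w(2) less.prems by simp
      moreover have "(Q * P) $$ (i, i) = row Q i \<bullet> col P i"
        using w(6,7) less.prems by simp
      moreover have "row Q i \<in> carrier_vec n"
        by (rule carrier_vecI) (use w(7) in simp)
      ultimately show False by (simp add: p_def)
    qed
  qed
  then have off: "?J $$ (i, j) = 0" if "i < n" "j < n" "i \<noteq> j" for i j
    using jordan_matrix_off_diagonal(1)[of i n_as j] that dim by metis
  have "?J = mat_diag n (\<lambda>i. ?J $$ (i, i))"
    by (rule eq_matI) (auto simp: mat_diag_def dim intro: off)
  then show thesis
    using wit that by metis
qed

section \<open>Spectral data read off a diagonalization\<close>

lemma diag_mat_mat_diag: "diag_mat (mat_diag n d) = map d [0..<n]"
  by (auto simp: diag_mat_def mat_diag_def)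

lemma order_prod_list_linear:
  "order x (\<Prod>a\<leftarrow>as. [:- a, 1:]) = count_list as (x :: 'a :: field)"
proof (induction as)
  case (Cons a as)
  have "(\<Prod>a\<leftarrow>as. [:- a, 1:]) \<noteq> 0" by (auto simp: prod_list_zero_iff)
  then show ?case
    using Cons order_power_n_n[of a 1]
    by (auto simp: order_mult order_0I simp del: mult_pCons_left)
qed simp

lemma count_list_map_upt: "count_list (map d [0..<n]) x = card {i. i < n \<and> d i = x}"
proof (induction n)
  case (Suc n)
  have "{i. i < Suc n \<and> d i = x} = (if d n = x then {n} else {}) \<union> {i. i < n \<and> d i = x}"
    by (auto simp: less_Suc_eq)
  then show ?case using Suc by simp
qed simp

context
  fixes A P Q :: "real mat" and d n
  assumes A: "A \<in> carrier_mat n n" and wit: "similar_mat_wit A (mat_diag n d) P Q"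
begin

lemma diagonalized_char_poly: "char_poly A = (\<Prod>a\<leftarrow>map d [0..<n]. [:- a, 1:])"
proof -
  have "char_poly A = char_poly (mat_diag n d)"
    using wit by (intro char_poly_similar) (auto simp: similar_mat_def)
  also have "\<dots> = (\<Prod>a\<leftarrow>diag_mat (mat_diag n d). [:- a, 1:])"
    by (rule char_poly_upper_triangular[of _ n]) (auto simp: mat_diag_def)
  finally show ?thesis by (simp add: diag_mat_mat_diag)
qed

lemma diagonalized_order: "order x (char_poly A) = card {i. i < n \<and> d i = x}"
  by (simp only: diagonalized_char_poly order_prod_list_linear count_list_map_upt)

lemma diagonalized_spectrum: "spectrum A = d ` {..<n}"
  unfolding spectrum_root_char_poly[OF A] diagonalized_char_poly poly_prod_list
  by (auto simp: prod_list_zero_iff)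

text \<open>Cyclicity of the trace, written out: exchanging the sums turns the factors
  \<open>P\<close> and \<open>Q\<close> into diagonal entries of \<open>Q * P\<close>.\<close>

lemma diagonalized_trace: "(\<Sum>i<n. A $$ (i, i)) = (\<Sum>i<n. d i)"
proof -
  note w = similar_mat_witD2[OF A wit]
  have "(\<Sum>i<n. A $$ (i, i)) = (\<Sum>i<n. \<Sum>r<n. P $$ (i, r) * d r * Q $$ (r, i))"
    using w by (subst w(3)) (auto intro!: sum.cong simp: mat_diag_mult_right[of _ n] scalar_prod_def lessThan_atLeast0)
  also have "\<dots> = (\<Sum>r<n. d r * (\<Sum>i<n. Q $$ (r, i) * P $$ (i, r)))"
    by (subst sum.swap) (simp add: sum_distrib_left mult_ac)
  also have "\<dots> = (\<Sum>r<n. d r * (Q * P) $$ (r, r))"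
    using w(6,7) by (auto intro!: sum.cong simp: scalar_prod_def lessThan_atLeast0)
  finally show ?thesis using w(2) by simp
qed

lemma diagonalized_scalar:
  assumes "\<And>i. i < n \<Longrightarrow> d i = e"
  shows "A = e \<cdot>\<^sub>m 1\<^sub>m n"
proof -
  note w = similar_mat_witD2[OF A wit]
  have "mat_diag n d = e \<cdot>\<^sub>m 1\<^sub>m n"
    using assms by (intro eq_matI) (auto simp: mat_diag_def)
  then have "A = P * (e \<cdot>\<^sub>m 1\<^sub>m n) * Q" using w(3) by simp
  also have "\<dots> = e \<cdot>\<^sub>m (P * Q)"
    using w(6,7) mult_smult_distrib[of P n n "1\<^sub>m n" n e] mult_smult_assoc_mat[of P n n Q n e]
    by simp
  finally show ?thesis using w(1) by simp
qed

text \<open>Quadratic relations are invariant under similarity, and for a diagonal matrix they hold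
  entrywise. Both directions are needed later: two eigenvalues yield a relation for
  \<open>A\<close>, and idempotence yields eigenvalues 0 and 1.\<close>

lemma diagonalized_quadratic:
  "A * A = s \<cdot>\<^sub>m A + t \<cdot>\<^sub>m 1\<^sub>m n \<longleftrightarrow> (\<forall>i<n. d i * d i = s * d i + t)"
proof -
  note w = similar_mat_witD2[OF A wit]
  let ?D = "mat_diag n d"
  let ?X = "\<lambda>M. M * M = s \<cdot>\<^sub>m M + t \<cdot>\<^sub>m 1\<^sub>m n"
  have conj: "?X N" if X: "?X M" and wit': "similar_mat_wit M N U V" and M: "M \<in> carrier_mat n n" for M N U V
  proof -
    have N: "N \<in> carrier_mat n n" using similar_mat_witD2(5)[OF M wit'] .
    note wit'' = similar_mat_wit_sym[OF wit']
    note w' = similar_mat_witD2[OF N wit'']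
    have "N * N = V * (M * M) * U"
      using similar_mat_wit_pow_id[OF wit'', of 2] M N by (simp add: numeral_2_eq_2)
    also have "\<dots> = V * (s \<cdot>\<^sub>m M + t \<cdot>\<^sub>m 1\<^sub>m n) * U" by (simp add: X)
    also have "\<dots> = V * (s \<cdot>\<^sub>m M) * U + V * (t \<cdot>\<^sub>m 1\<^sub>m n) * U"
      using w' M by (simp add: mult_add_distrib_mat[of _ n n _ n] add_mult_distrib_mat[of _ n n])
    also have "\<dots> = s \<cdot>\<^sub>m (V * M * U) + t \<cdot>\<^sub>m (V * U)"
      using w' M mult_smult_distrib[of V n n M n s] mult_smult_distrib[of V n n "1\<^sub>m n" n t]
        mult_smult_assoc_mat[of "V * M" n n U n s] mult_smult_assoc_mat[of V n n U n t]
      by simp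
    finally show ?thesis using w'(1,3) by simp
  qed
  have "?X A \<longleftrightarrow> ?X ?D"
    using conj[OF _ wit A] conj[OF _ similar_mat_wit_sym[OF wit] w(5)] by blast
  also have "\<dots> \<longleftrightarrow> (\<forall>i<n. d i * d i = s * d i + t)"
    unfolding mat_diag_diag by (auto simp: mat_eq_iff mat_diag_def)
  finally show ?thesis .
qed

end

section \<open>Symmetric idempotents\<close>

text \<open>Bessel's inequality for the orthogonal vectors \<open>E e\<^sub>u\<close>, summed over all unit vectors.\<close>

lemma card_le_trace_symmetric_idempotent:
  fixes E :: "nat \<Rightarrow> nat \<Rightarrow> real"
  assumes sym: "\<And>a b. a < n \<Longrightarrow> b < n \<Longrightarrow> E a b = E b a"
    and idem: "\<And>a b. a < n \<Longrightarrow> b < n \<Longrightarrow> (\<Sum>c<n. E a c * E c b) = E a b"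
    and U: "U \<subseteq> {..<n}"
    and off: "\<And>u v. u \<in> U \<Longrightarrow> v \<in> U \<Longrightarrow> u \<noteq> v \<Longrightarrow> E u v = 0"
    and diag: "\<And>u. u \<in> U \<Longrightarrow> E u u \<noteq> 0"
  shows "real (card U) \<le> (\<Sum>a<n. E a a)"
proof -
  have fin: "finite U" using U finite_subset by blast
  have U': "u < n" if "u \<in> U" for u using U that by auto
  have bessel: "(\<Sum>u\<in>U. E a u * E u a / E u u) \<le> E a a" if a: "a < n" for a
  proof -
    \<comment> \<open>\<open>F\<close> is the orthogonal projection of column \<open>a\<close> onto
      the span of the columns indexed by \<open>U\<close>; by idempotence \<open>E u u\<close> is
      the squared length of column \<open>u\<close>.\<close>
    define F where "F b = (\<Sum>u\<in>U. E a u / E u u * E u b)" for b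
    have cross: "(\<Sum>b<n. E a b * F b) = F a"
    proof -
      have "(\<Sum>b<n. E a b * F b) = (\<Sum>u\<in>U. E a u / E u u * (\<Sum>b<n. E u b * E b a))"
        unfolding F_def sum_distrib_left
        by (subst sum.swap) (auto intro!: sum.cong simp: sym[OF a] mult_ac)
      also have "\<dots> = F a"
        unfolding F_def by (intro sum.cong) (use U' a in \<open>auto simp: idem\<close>)
      finally show ?thesis .
    qed
    have inner: "(\<Sum>b<n. E u b * F b) = E u a" if u: "u \<in> U" for u
    proof -
      have "(\<Sum>b<n. E u b * F b) = (\<Sum>v\<in>U. E a v / E v v * (\<Sum>b<n. E u b * E b v))"
        unfolding F_def sum_distrib_left
        by (subst sum.swap) (auto intro!: sum.cong simp: sym U' mult_ac)
      also have "\<dots> = (\<Sum>v\<in>U. if v = u then E a u else 0)"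
        by (intro sum.cong) (use u U' off diag in \<open>auto simp: idem\<close>)
      finally show ?thesis using u fin a U' by (simp add: sym)
    qed
    have square: "(\<Sum>b<n. F b * F b) = F a"
    proof -
      have "(\<Sum>b<n. F b * F b) = (\<Sum>u\<in>U. E a u / E u u * (\<Sum>b<n. E u b * F b))"
        unfolding sum_distrib_left
        by (subst sum.swap) (auto intro!: sum.cong simp: F_def sum_distrib_right mult_ac)
      also have "\<dots> = (\<Sum>u\<in>U. E a u / E u u * E u a)"
        by (intro sum.cong) (auto simp: inner)
      also have "\<dots> = F a" by (simp add: F_def)
      finally show ?thesis .
    qed
    \<comment> \<open>Squared distance between column \<open>a\<close> and its projection; the cross
      sum and the square sum both equal \<open>F a\<close>.\<close>
    have "0 \<le> (\<Sum>b<n. (E a b - F b)\<^sup>2)" by (simp add: sum_nonneg)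
    also have "\<dots> = (\<Sum>b<n. E a b * E b a) - 2 * (\<Sum>b<n. E a b * F b) + (\<Sum>b<n. F b * F b)"
      unfolding sum_distrib_left sum_subtractf[symmetric] sum.distrib[symmetric]
      by (intro sum.cong) (auto simp: sym[OF a] power2_eq_square algebra_simps)
    also have "\<dots> = E a a - F a" by (simp add: cross square idem a)
    finally show ?thesis by (simp add: F_def)
  qed
  \<comment> \<open>Each \<open>u\<close> contributes 1, since the squared length of column
    \<open>u\<close> is \<open>E u u\<close>; after exchanging the sums, \<open>bessel\<close>
    applies for each \<open>a\<close>.\<close>
  have "real (card U) = (\<Sum>u\<in>U. (\<Sum>a<n. E u a * E a u) / E u u)"
    using diag by (simp add: idem U')
  also have "\<dots> = (\<Sum>a<n. \<Sum>u\<in>U. E a u * E u a / E u u)"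
    unfolding sum_divide_distrib by (subst sum.swap) (simp add: mult_ac)
  also have "\<dots> \<le> (\<Sum>a<n. E a a)"
    by (intro sum_mono) (use bessel in auto)
  finally show ?thesis .
qed

section \<open>Orthogonal matrices in general position\<close>

text \<open>Row relations will fix the zero pattern inside a factor, column relations the
  orthonormality of the columns of \<open>B\<close>; recording both makes each directly
  available.\<close>

definition orthogonal_entries :: "nat \<Rightarrow> (nat \<Rightarrow> nat \<Rightarrow> real) \<Rightarrow> bool" where
  "orthogonal_entries k Q \<longleftrightarrow>
     (\<forall>i<k. \<forall>j<k. (\<Sum>c<k. Q i c * Q j c) = of_bool (i = j)) \<and>
     (\<forall>c<k. \<forall>c'<k. (\<Sum>i<k. Q i c * Q i c') = of_bool (c = c'))"

text \<open>Householder reflection in the hyperplane orthogonal to \<open>w\<close>.\<close>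

lemma orthogonal_entries_householder:
  fixes w :: "nat \<Rightarrow> real"
  assumes W: "(\<Sum>c<k. w c * w c) \<noteq> 0"
  defines "Q \<equiv> \<lambda>i c. of_bool (i = c) - 2 * w i * w c / (\<Sum>c<k. w c * w c)"
  shows "orthogonal_entries k Q"
proof -
  let ?W = "\<Sum>c<k. w c * w c"
  have sym: "Q i c = Q c i" for i c by (auto simp: Q_def)
  have "(\<Sum>c<k. Q i c * Q j c) = of_bool (i = j)" if "i < k" "j < k" for i j
  proof -
    \<comment> \<open>\<open>s\<close> collects each mixed term and \<open>t\<close> the product of
      the two rank-one terms; they cancel because \<open>t * ?W = s + s\<close>.\<close>
    define s t where "s = 2 * w i * w j / ?W" and "t = 4 * w i * w j / ?W / ?W"
    have "Q i c * Q j c = (if c = i then of_bool (i = j) else 0)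
        - (if c = i then s else 0) - (if c = j then s else 0) + t * (w c * w c)" for c
      by (auto simp: Q_def s_def t_def algebra_simps)
    then have "(\<Sum>c<k. Q i c * Q j c) = of_bool (i = j) - s - s + t * ?W"
      using that by (simp add: sum.distrib sum_subtractf flip: sum_distrib_left)
    moreover have "t * ?W = s + s" using W by (simp add: s_def t_def)
    ultimately show ?thesis by simp
  qed
  moreover from this have "(\<Sum>i<k. Q i c * Q i c') = of_bool (c = c')" if "c < k" "c' < k" for c c'
    unfolding sym[of _ c] sym[of _ c'] using that by simp
  ultimately show ?thesis by (simp add: orthogonal_entries_def)
qed

text \<open>For the reflection along \<open>w = (1, x, \<dots>, x\<^sup>k\<^sup>-\<^sup>1)\<close>, each of the inner products that must not vanish
  is, up to the factor \<open>w \<bullet> w\<close>, a polynomial in \<open>x\<close>. Its constant coefficient is \<open>\<plusminus> f j\<close>.\<close>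

lemma orthogonal_entries_avoiding:
  fixes F :: "(nat \<Rightarrow> real) set"
  assumes fin: "finite F" and nz: "\<And>f. f \<in> F \<Longrightarrow> \<exists>c<k. f c \<noteq> 0"
  obtains Q where "orthogonal_entries k Q" "\<And>f j. f \<in> F \<Longrightarrow> j < k \<Longrightarrow> (\<Sum>c<k. f c * Q j c) \<noteq> 0"
proof -
  define p where "p f j = Polynomial.smult (f j) (\<Sum>c<k. monom 1 (2 * c))
      - monom 2 j * (\<Sum>c<k. monom (f c) c)" for f :: "nat \<Rightarrow> real" and j
  have p_nz: "p f j \<noteq> 0" if f: "f \<in> F" and j: "j < k" for f j
  proof
    assume 0: "p f j = 0"
    have coeff_W: "coeff (\<Sum>c<k. monom (1 :: real) (2 * c)) 0 = 1"
    proof -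
      have "coeff (\<Sum>c<k. monom (1 :: real) (2 * c)) 0 = (\<Sum>c<k. if c = 0 then 1 else 0)"
        by (auto simp: coeff_sum intro!: sum.cong)
      then show ?thesis using j by simp
    qed
    have coeff_S: "coeff (\<Sum>c<k. monom (f c) c) i = (if i < k then f i else 0)" for i
      by (simp add: coeff_sum)
    \<comment> \<open>The first summand contributes \<open>f j\<close>. The second contributes
      \<open>2 * f 0\<close> for \<open>j = 0\<close> and nothing otherwise, hence the sign.\<close>
    have "coeff (p f j) 0 = (if j = 0 then - f j else f j)"
      using j by (auto simp: p_def coeff_W coeff_S coeff_mult_0)
    then have "f j = 0" using 0 by (auto split: if_splits)
    \<comment> \<open>With \<open>f j = 0\<close> only this product survives, and the coefficients
      of its second factor are the entries of \<open>f\<close>.\<close>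
    then have "monom 2 j * (\<Sum>c<k. monom (f c) c) = 0" using 0 by (simp add: p_def)
    then have "(\<Sum>c<k. monom (f c) c) = 0" by simp
    then have "\<forall>c<k. f c = 0" using coeff_S by (metis coeff_0)
    with nz[OF f] show False by blast
  qed
  \<comment> \<open>Finitely many nonzero polynomials have finitely many roots, so some real
    \<open>x\<close> avoids them all.\<close>
  have "finite (\<Union>f\<in>F. \<Union>j<k. {x. poly (p f j) x = 0})"
    using fin p_nz by (auto intro!: poly_roots_finite)
  then obtain x where x: "x \<notin> (\<Union>f\<in>F. \<Union>j<k. {x. poly (p f j) x = 0})"
    using ex_new_if_finite infinite_UNIV_char_0 by blast
  define W where "W = (\<Sum>c<k. x ^ c * x ^ c)"
  have W: "W \<noteq> 0" if "k > 0"
  proof -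
    have "x ^ 0 * x ^ 0 \<le> W" unfolding W_def
      by (rule member_le_sum) (use that in auto)
    then show ?thesis by auto
  qed
  define Q where "Q i c = of_bool (i = c) - 2 * x ^ i * x ^ c / W" for i c
  show thesis
  proof
    show "orthogonal_entries k Q"
    \<comment> \<open>For \<open>k = 0\<close> the squared norm of the reflection vector is an empty
      sum, so the reflection lemma does not apply.\<close>
    proof (cases "k = 0")
      case False
      then show ?thesis
        using orthogonal_entries_householder[of "\<lambda>c. x ^ c" k] W by (simp add: Q_def[abs_def] W_def)
    qed (simp add: orthogonal_entries_def)
    fix f j assume f: "f \<in> F" and j: "j < k"
    have "(\<Sum>c<k. f c * Q j c) = (\<Sum>c<k. if c = j then f j else 0) - 2 * x ^ j / W * (\<Sum>c<k. f c * x ^ c)"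
      unfolding sum_distrib_left sum_subtractf[symmetric]
      by (intro sum.cong) (auto simp: Q_def algebra_simps)
    also have "\<dots> = f j - 2 * x ^ j / W * (\<Sum>c<k. f c * x ^ c)" using j by simp
    also have "\<dots> = (f j * W - 2 * x ^ j * (\<Sum>c<k. f c * x ^ c)) / W"
      using j W by (simp add: diff_divide_distrib)
    also have "f j * W - 2 * x ^ j * (\<Sum>c<k. f c * x ^ c) = poly (p f j) x"
    proof -
      have "W = (\<Sum>c<k. x ^ (2 * c))" by (simp add: W_def mult_2 power_add)
      then show ?thesis by (simp add: p_def poly_sum poly_monom)
    qed
    finally show "(\<Sum>c<k. f c * Q j c) \<noteq> 0"
      using x f j W by auto
  qed
qed

text \<open>Induction on \<open>l\<close>: the rows chosen so far are unit vectors, hence nonzero,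
  so a further matrix avoiding all of them exists. The induction treats \<open>i' < i\<close> only;
  commutativity gives the other order.\<close>

lemma orthogonal_entries_family:
  fixes l k :: nat
  obtains Q where "\<And>i. i < l \<Longrightarrow> orthogonal_entries k (Q i)"
    "\<And>i i' j j'. i < l \<Longrightarrow> i' < l \<Longrightarrow> i \<noteq> i' \<Longrightarrow> j < k \<Longrightarrow> j' < k \<Longrightarrow> (\<Sum>c<k. Q i j c * Q i' j' c) \<noteq> 0"
proof -
  have "\<exists>Q. (\<forall>i<l. orthogonal_entries k (Q i)) \<and>
    (\<forall>i<l. \<forall>i'<i. \<forall>j<k. \<forall>j'<k. (\<Sum>c<k. Q i' j' c * Q i j c) \<noteq> 0)"
  proof (induction l)
    case (Suc l)
    then obtain Q where Q: "\<forall>i<l. orthogonal_entries k (Q i)"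
      "\<forall>i<l. \<forall>i'<i. \<forall>j<k. \<forall>j'<k. (\<Sum>c<k. Q i' j' c * Q i j c) \<noteq> 0" by blast
    let ?F = "(\<lambda>(i, j). Q i j) ` ({..<l} \<times> {..<k})"
    have "\<exists>c<k. f c \<noteq> 0" if "f \<in> ?F" for f
    proof (rule ccontr)
      assume 0: "\<not> (\<exists>c<k. f c \<noteq> 0)"
      from that obtain i j where "i < l" "j < k" "f = Q i j" by auto
      then have "(\<Sum>c<k. f c * f c) = 1" using Q(1) by (simp add: orthogonal_entries_def)
      with 0 show False by simp
    qed
    then obtain R where R: "orthogonal_entries k R"
      "\<And>f j. f \<in> ?F \<Longrightarrow> j < k \<Longrightarrow> (\<Sum>c<k. f c * R j c) \<noteq> 0"
      using orthogonal_entries_avoiding[of ?F k] by blast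
    have R2: "(\<Sum>c<k. Q i' j' c * R j c) \<noteq> 0" if "i' < l" "j' < k" "j < k" for i' j' j
      using R(2)[of "Q i' j'" j] that by force
    show ?case
    proof (intro exI[of _ "Q(l := R)"] conjI allI impI)
      fix i assume "i < Suc l"
      then show "orthogonal_entries k ((Q(l := R)) i)" using Q R by (auto simp: less_Suc_eq)
    next
      fix i i' j j' assume "i < Suc l" "i' < i" "j < k" "j' < k"
      then show "(\<Sum>c<k. (Q(l := R)) i' j' c * (Q(l := R)) i j c) \<noteq> 0"
        using Q(2) R2 by (cases "i = l") auto
    qed
  qed simp
  then obtain Q where Q: "\<forall>i<l. orthogonal_entries k (Q i)"
      "\<forall>i<l. \<forall>i'<i. \<forall>j<k. \<forall>j'<k. (\<Sum>c<k. Q i' j' c * Q i j c) \<noteq> 0" by blast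
  show thesis
  proof
    fix i i' j j' assume *: "i < l" "i' < l" "i \<noteq> i'" "j < k" "j' < k"
    show "(\<Sum>c<k. Q i j c * Q i' j' c) \<noteq> 0"
    proof (cases "i' < i")
      case True
      have "(\<Sum>c<k. Q i j c * Q i' j' c) = (\<Sum>c<k. Q i' j' c * Q i j c)"
        by (simp add: mult.commute)
      with True show ?thesis using Q(2) * by simp
    next
      case False
      then show ?thesis using Q(2) * by simp
    qed
  qed (use Q in auto)
qed

section \<open>Multiplicity bipartitions\<close>

text \<open>With a single eigenvalue a diagonalizable matrix is scalar, but the arc forces a nonzero
  off-diagonal entry.\<close>

lemma graph_matrix_spectrum_card_ge_2:
  assumes A: "A \<in> \<S> G"
    and arc: "(u, v) \<in> parcs G" "u \<in> pverts G" "v \<in> pverts G" "u \<noteq> v"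
  shows "2 \<le> q_mat A"
proof (rule ccontr)
  assume less: "\<not> 2 \<le> q_mat A"
  define n where "n = card (pverts G)"
  from A obtain f where cA: "A \<in> carrier_mat n n" and sym: "transpose_mat A = A"
    and f: "bij_betw f {..<n} (pverts G)"
    and pat: "\<And>i j. i < n \<Longrightarrow> j < n \<Longrightarrow> i \<noteq> j \<Longrightarrow> A $$ (i, j) \<noteq> 0 \<longleftrightarrow> (f i, f j) \<in> parcs G"
    by (auto simp: graph_matrices_def Let_def n_def)
  obtain d P Q where wit: "similar_mat_wit A (mat_diag n d) P Q"
    using real_symmetric_diagonalizable[OF cA sym] .
  from arc f obtain i j where ij: "i < n" "j < n" "f i = u" "f j = v"
    by (auto simp: bij_betw_def) (metis imageE lessThan_iff)
  have "card (d ` {..<n}) \<le> Suc 0"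
    using less diagonalized_spectrum[OF cA wit] by (simp add: q_mat_def)
  then have eq: "x = y" if "x \<in> d ` {..<n}" "y \<in> d ` {..<n}" for x y
    using that card_le_Suc0_iff_eq[of "d ` {..<n}"] by blast
  have "d a = d i" if "a < n" for a
    by (rule eq) (use that ij in auto)
  then have "A = d i \<cdot>\<^sub>m 1\<^sub>m n"
    by (rule diagonalized_scalar[OF cA wit])
  then have "A $$ (i, j) = 0" using ij arc(4) by auto
  then show False using pat[of i j] ij arc by auto
qed

lemma card_independent_le:
  assumes ach: "achieves_bipartition G m"
    and U: "U \<subseteq> pverts G" and ind: "\<And>u v. u \<in> U \<Longrightarrow> v \<in> U \<Longrightarrow> (u, v) \<notin> parcs G"
    and nbr: "\<And>u. u \<in> U \<Longrightarrow> \<exists>v\<in>pverts G. v \<noteq> u \<and> (u, v) \<in> parcs G"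
  shows "card U \<le> m"
proof -
  define n where "n = card (pverts G)"
  from ach obtain A \<mu> \<nu> where A: "A \<in> \<S> G" and ne: "\<mu> \<noteq> \<nu>" and spec: "spectrum A = {\<mu>, \<nu>}"
    and ord: "order \<nu> (char_poly A) = m"
    by (auto simp: achieves_bipartition_def)
  from A obtain f where cA: "A \<in> carrier_mat n n" and sym: "transpose_mat A = A"
    and f: "bij_betw f {..<n} (pverts G)"
    and pat: "\<And>i j. i < n \<Longrightarrow> j < n \<Longrightarrow> i \<noteq> j \<Longrightarrow> A $$ (i, j) \<noteq> 0 \<longleftrightarrow> (f i, f j) \<in> parcs G"
    by (auto simp: graph_matrices_def Let_def n_def)
  obtain d P Q where wit: "similar_mat_wit A (mat_diag n d) P Q"
    using real_symmetric_diagonalizable[OF cA sym] .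
  have d: "d i = \<mu> \<or> d i = \<nu>" if "i < n" for i
    using spec diagonalized_spectrum[OF cA wit] that by auto
  have m: "m = card {i. i < n \<and> d i = \<nu>}"
    using ord diagonalized_order[OF cA wit] by simp
  \<comment> \<open>Expanded form of \<open>(d i - \<mu>) * (d i - \<nu>) = 0\<close>.\<close>
  have "d i * d i = (\<mu> + \<nu>) * d i + (- \<mu> * \<nu>)" if "i < n" for i
    using d[OF that] by (auto simp: algebra_simps)
  then have AA: "A * A = (\<mu> + \<nu>) \<cdot>\<^sub>m A + (- \<mu> * \<nu>) \<cdot>\<^sub>m 1\<^sub>m n"
    using diagonalized_quadratic[OF cA wit] by blast
  \<comment> \<open>The spectral projection for \<open>\<nu>\<close>. Off the diagonal it vanishes
    exactly where \<open>A\<close> does.\<close>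
  define E where "E i j = (A $$ (i, j) - \<mu> * of_bool (i = j)) / (\<nu> - \<mu>)" for i j
  have A_sym: "A $$ (i, j) = A $$ (j, i)" if "i < n" "j < n" for i j
    using arg_cong[OF sym, of "\<lambda>M. M $$ (i, j)"] that cA by simp
  have E_sym: "E i j = E j i" if "i < n" "j < n" for i j
    using A_sym[OF that] by (auto simp: E_def)
  have idem: "(\<Sum>c<n. E i c * E c j) = E i j" if ij: "i < n" "j < n" for i j
  proof -
    have "(A * A) $$ (i, j) = (\<Sum>c<n. A $$ (i, c) * A $$ (c, j))"
      using cA ij by (auto simp: scalar_prod_def lessThan_atLeast0)
    moreover have "(A * A) $$ (i, j) = (\<mu> + \<nu>) * A $$ (i, j) - \<mu> * \<nu> * of_bool (i = j)"
      unfolding AA using cA ij by simp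
    ultimately have sq: "(\<Sum>c<n. A $$ (i, c) * A $$ (c, j)) = (\<mu> + \<nu>) * A $$ (i, j) - \<mu> * \<nu> * of_bool (i = j)"
      by simp
    \<comment> \<open>Clearing denominators turns idempotence into an identity for the square of
      \<open>A\<close> minus \<open>\<mu>\<close> times the identity, which follows from
      \<open>sq\<close>.\<close>
    have "(\<nu> - \<mu>) * (\<nu> - \<mu>) * (\<Sum>c<n. E i c * E c j)
        = (\<Sum>c<n. (A $$ (i, c) - \<mu> * of_bool (i = c)) * (A $$ (c, j) - \<mu> * of_bool (c = j)))"
      unfolding sum_distrib_left using ne by (intro sum.cong) (auto simp: E_def)
    also have "\<dots> = (\<Sum>c<n. A $$ (i, c) * A $$ (c, j) - (if c = j then \<mu> * A $$ (i, j) else 0)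
        - (if c = i then \<mu> * A $$ (i, j) else 0) + (if c = i then \<mu> * \<mu> * of_bool (i = j) else 0))"
      by (intro sum.cong) (auto simp: algebra_simps)
    also have "\<dots> = (\<nu> - \<mu>) * (A $$ (i, j) - \<mu> * of_bool (i = j))"
      using ij by (simp add: sum.distrib sum_subtractf sq) (simp add: algebra_simps)
    also have "\<dots> = (\<nu> - \<mu>) * (\<nu> - \<mu>) * E i j"
      using ne by (simp add: E_def)
    finally show ?thesis using ne by simp
  qed
  define I where "I = {i. i < n \<and> f i \<in> U}"
  have fI: "bij_betw f I U"
    using f U by (auto simp: bij_betw_def I_def inj_on_def image_iff subset_iff)
  have "real (card I) \<le> (\<Sum>i<n. E i i)"
  proof (rule card_le_trace_symmetric_idempotent[where E = E])
    fix i j assume ij: "i \<in> I" "j \<in> I" "i \<noteq> j"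
    then show "E i j = 0" using pat[of i j] ind by (auto simp: E_def I_def)
  next
    fix i assume i: "i \<in> I"
    then obtain v where v: "v \<in> pverts G" "v \<noteq> f i" "(f i, v) \<in> parcs G"
      using nbr by (auto simp: I_def)
    obtain j where j: "j < n" "f j = v"
      using v(1) f by (auto simp: bij_betw_def) (metis imageE lessThan_iff)
    have nz: "E i j \<noteq> 0" using pat[of i j] i j v ne by (auto simp: E_def I_def)
    \<comment> \<open>By symmetry and idempotence \<open>E i i\<close> is a sum of squares, bounded
      below by the positive square belonging to the neighbour \<open>j\<close>.\<close>
    have "E i j * E j i \<le> (\<Sum>c<n. E i c * E c i)"
      using i j by (intro member_le_sum) (auto simp: I_def E_sym)
    also have "\<dots> = E i i" using idem i by (simp add: I_def)
    finally show "E i i \<noteq> 0"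
      using nz E_sym[of i j] i j by (auto simp: I_def not_sum_squares_lt_zero mult_le_0_iff)
  qed (use E_sym idem in \<open>auto simp: I_def\<close>)
  also have "\<dots> = ((\<Sum>i<n. A $$ (i, i)) - n * \<mu>) / (\<nu> - \<mu>)"
    by (simp add: E_def sum_subtractf flip: sum_divide_distrib)
  also have "\<dots> = (\<Sum>i<n. d i - \<mu>) / (\<nu> - \<mu>)"
    by (simp add: diagonalized_trace[OF cA wit] sum_subtractf)
  \<comment> \<open>Each quotient is 0 or 1, so the trace counts the indices with eigenvalue
    \<open>\<nu>\<close>.\<close>
  also have "\<dots> = (\<Sum>i<n. of_bool (d i = \<nu>))"
    unfolding sum_divide_distrib by (intro sum.cong) (use d ne in auto)
  also have "\<dots> = m" by (simp add: m Int_def)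
  finally show ?thesis using bij_betw_same_card[OF fI] by simp
qed

text \<open>The vectors \<open>b v\<close> are the rows of a matrix \<open>B\<close> with orthonormal columns, so \<open>B B\<^sup>T\<close> is an
  orthogonal projection of rank \<open>k\<close>.\<close>

lemma achieves_bipartition_if_representation:
  fixes b :: "'v \<Rightarrow> nat \<Rightarrow> real"
  assumes fin: "finite (pverts G)" and k: "1 \<le> k" "2 * k \<le> card (pverts G)"
    and orth: "\<And>c c'. c < k \<Longrightarrow> c' < k \<Longrightarrow> (\<Sum>v\<in>pverts G. b v c * b v c') = of_bool (c = c')"
    and pat: "\<And>u v. u \<in> pverts G \<Longrightarrow> v \<in> pverts G \<Longrightarrow> u \<noteq> v \<Longrightarrow>
      (\<Sum>c<k. b u c * b v c) \<noteq> 0 \<longleftrightarrow> (u, v) \<in> parcs G"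
  shows "achieves_bipartition G k"
proof -
  define n where "n = card (pverts G)"
  obtain f where f: "bij_betw f {..<n} (pverts G)"
    using ex_bij_betw_nat_finite[OF fin] by (auto simp: n_def lessThan_atLeast0)
  have orth_f: "(\<Sum>i<n. b (f i) c * b (f i) c') = of_bool (c = c')" if "c < k" "c' < k" for c c'
    using orth[OF that] sum.reindex_bij_betw[OF f, of "\<lambda>v. b v c * b v c'"] by simp
  define A where "A = mat n n (\<lambda>(i, j). \<Sum>c<k. b (f i) c * b (f j) c)"
  have cA: "A \<in> carrier_mat n n" by (simp add: A_def)
  have sym: "transpose_mat A = A"
    by (rule eq_matI) (auto simp: A_def mult.commute)
  have AG: "A \<in> \<S> G"
  proof -
    have "A $$ (i, j) \<noteq> 0 \<longleftrightarrow> (f i, f j) \<in> parcs G" if "i < n" "j < n" "i \<noteq> j" for i j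
      using that pat[of "f i" "f j"] f by (auto simp: A_def bij_betw_def inj_on_def)
    then show ?thesis
      using cA sym f by (auto simp: graph_matrices_def Let_def simp flip: n_def)
  qed
  obtain d P Q where wit: "similar_mat_wit A (mat_diag n d) P Q"
    using real_symmetric_diagonalizable[OF cA sym] .
  \<comment> \<open>With \<open>A\<close> equal to \<open>B\<close> times its transpose, the inner
    factor of the product is the Gram matrix of the columns of \<open>B\<close>, which is the
    identity.\<close>
  have "A * A = A"
  proof (rule eq_matI)
    fix i j assume "i < dim_row A" "j < dim_col A"
    then have ij: "i < n" "j < n" using cA by auto
    then have "(A * A) $$ (i, j) = (\<Sum>s<n. (\<Sum>c<k. b (f i) c * b (f s) c) * (\<Sum>c'<k. b (f s) c' * b (f j) c'))"
      by (auto simp: A_def scalar_prod_def lessThan_atLeast0)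
    also have "\<dots> = (\<Sum>s<n. \<Sum>c<k. \<Sum>c'<k. b (f i) c * b (f j) c' * (b (f s) c * b (f s) c'))"
      by (simp add: sum_product mult_ac)
    also have "\<dots> = (\<Sum>c<k. \<Sum>s<n. \<Sum>c'<k. b (f i) c * b (f j) c' * (b (f s) c * b (f s) c'))"
      by (rule sum.swap)
    also have "\<dots> = (\<Sum>c<k. \<Sum>c'<k. \<Sum>s<n. b (f i) c * b (f j) c' * (b (f s) c * b (f s) c'))"
      by (intro sum.cong refl sum.swap)
    also have "\<dots> = (\<Sum>c<k. \<Sum>c'<k. if c = c' then b (f i) c * b (f j) c else 0)"
      by (intro sum.cong) (auto simp: orth_f simp flip: sum_distrib_left)
    also have "\<dots> = A $$ (i, j)" using ij by (simp add: A_def)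
    finally show "(A * A) $$ (i, j) = A $$ (i, j)" .
  qed (use cA in auto)
  then have "A * A = 1 \<cdot>\<^sub>m A + 0 \<cdot>\<^sub>m 1\<^sub>m n"
    using cA by (intro eq_matI) auto
  then have d: "d i = 0 \<or> d i = 1" if "i < n" for i
    using diagonalized_quadratic[OF cA wit, of 1 0] that by auto
  have one: "order 1 (char_poly A) = k"
  proof -
    \<comment> \<open>As all eigenvalues are 0 or 1, the multiplicity of 1 is the trace, which is
      the sum of the squared lengths of the \<open>k\<close> columns of \<open>B\<close>.\<close>
    have "real (card {i. i < n \<and> d i = 1}) = (\<Sum>i<n. of_bool (d i = 1))"
      by (simp add: Int_def)
    also have "\<dots> = (\<Sum>i<n. d i)"
      by (intro sum.cong) (use d in auto)
    also have "\<dots> = (\<Sum>i<n. A $$ (i, i))"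
      by (simp add: diagonalized_trace[OF cA wit])
    also have "\<dots> = (\<Sum>c<k. \<Sum>i<n. b (f i) c * b (f i) c)"
      by (subst sum.swap) (simp add: A_def)
    also have "\<dots> = k" by (simp add: orth_f)
    finally show ?thesis by (simp add: diagonalized_order[OF cA wit])
  qed
  have zero: "order 0 (char_poly A) = n - k"
  proof -
    have "{i. i < n \<and> d i = 0} = {..<n} - {i. i < n \<and> d i = 1}" using d by auto
    then have "card {i. i < n \<and> d i = 0} = n - card {i. i < n \<and> d i = 1}"
      by (simp add: card_Diff_subset Collect_mono subset_eq)
    then show ?thesis using one by (simp add: diagonalized_order[OF cA wit])
  qed
  have "spectrum A = {0, 1}"
  proof -
    have "\<exists>i<n. d i = 1"
    proof (rule ccontr)
      assume "\<not> (\<exists>i<n. d i = 1)"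
      then have "{i. i < n \<and> d i = 1} = {}" by auto
      then have "card {i. i < n \<and> d i = 1} = 0" by (simp only: card.empty)
      then show False using one k(1) diagonalized_order[OF cA wit, of 1] by linarith
    qed
    \<comment> \<open>The multiplicity \<open>n - k\<close> is positive because
      \<open>1 \<le> k\<close> and \<open>2 * k \<le> n\<close>.\<close>
    moreover have "\<exists>i<n. d i = 0"
    proof (rule ccontr)
      assume "\<not> (\<exists>i<n. d i = 0)"
      then have "{i. i < n \<and> d i = 0} = {}" by auto
      then have "card {i. i < n \<and> d i = 0} = 0" by (simp only: card.empty)
      then show False using zero k n_def diagonalized_order[OF cA wit, of 0] by linarith
    qed
    ultimately show ?thesis
      unfolding diagonalized_spectrum[OF cA wit] using d by (auto simp: image_iff)
  qed
  then show ?thesis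
    unfolding achieves_bipartition_def n_def[symmetric]
    using AG k zero one
    by (intro conjI bexI[of _ A] exI[of _ "0 :: real"] exI[of _ "1 :: real"]) (simp_all add: n_def)
qed

text \<open>For \<open>l = 1\<close> the graph is a disjoint union of cliques, and a clique of size
  1 would be an isolated vertex. The union of \<open>K_1\<close> and \<open>K_3\<close>, for
  example, achieves the bipartition [3,1], although \<open>k = 2\<close>.\<close>

theorem corollary3p7:
  fixes l k :: nat and a :: "nat \<Rightarrow> nat \<Rightarrow> nat"
    and G :: "(nat \<times> nat \<times> nat) pair_pre_digraph"
  assumes "l \<ge> 1" and "k \<ge> 2"
    and "\<forall>i\<in>{1..l}. \<forall>j\<in>{1..k}. a i j > 0"
    and "l = 1 \<longrightarrow> (\<forall>j\<in>{1..k}. a 1 j \<ge> 2)"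
    and "G = graph_join {1..l} (\<lambda>i. graph_union {1..k} (\<lambda>j. complete_graph (a i j)))"
  shows "q G = 2 \<and> MB G = k"
proof -
  have V: "pverts G = (SIGMA i:{1..l}. SIGMA j:{1..k}. {..<a i j})"
    using assms(5) by (simp add: graph_join_def graph_union_def complete_graph_def)
  have fin: "finite (pverts G)" by (simp add: V)
  have arc: "((i, j, x), (i', j', x')) \<in> parcs G \<longleftrightarrow>
      i \<noteq> i' \<or> j = j' \<and> x \<noteq> x'"
    if "(i, j, x) \<in> pverts G" "(i', j', x') \<in> pverts G" for i j x i' j' x'
    using that unfolding V
    by (auto simp: assms(5) graph_join_def graph_union_def complete_graph_def)
  have sum_V: "(\<Sum>v\<in>pverts G. g v) = (\<Sum>i\<in>{1..l}. \<Sum>j\<in>{1..k}. \<Sum>x<a i j. g (i, j, x))"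
    for g :: "_ \<Rightarrow> 'b :: comm_monoid_add"
    unfolding V by (simp add: sum.Sigma split_def)
  have card_V: "2 * k \<le> card (pverts G)"
  proof -
    have card: "card (pverts G) = (\<Sum>i\<in>{1..l}. \<Sum>j\<in>{1..k}. a i j)"
      unfolding V by simp
    show ?thesis
    \<comment> \<open>A single factor has \<open>k\<close> cliques with at least two vertices each;
      several factors have at least \<open>2 * k\<close> nonempty cliques.\<close>
    proof (cases "l = 1")
      case True
      have "(\<Sum>j\<in>{1..k}. 2) \<le> (\<Sum>j\<in>{1..k}. a 1 j)"
        using assms(4) True by (intro sum_mono) auto
      then show ?thesis using True card by simp
    next
      case False
      have "2 * k \<le> (\<Sum>i\<in>{1..l}. \<Sum>j\<in>{1..k}. 1)" using assms(1) False by simp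
      also have "\<dots> \<le> card (pverts G)"
        unfolding card using assms(3) by (intro sum_mono) (auto simp: Suc_le_eq)
      finally show ?thesis .
    qed
  qed
  have achieved: "achieves_bipartition G k"
  proof -
    obtain Q where Q: "\<And>i. i < l \<Longrightarrow> orthogonal_entries k (Q i)"
      and Q': "\<And>i i' j j'. i < l \<Longrightarrow> i' < l \<Longrightarrow> i \<noteq> i' \<Longrightarrow> j < k \<Longrightarrow> j' < k \<Longrightarrow>
        (\<Sum>c<k. Q i j c * Q i' j' c) \<noteq> 0"
      using orthogonal_entries_family by blast
    \<comment> \<open>The row of clique \<open>(i, j)\<close> occurs \<open>a i j\<close> times and
      \<open>l\<close> orthogonal matrices are stacked; the scaling compensates for both. In
      \<open>b\<close>, the shifts by 1 pass to the zero-based indices of \<open>Q\<close>.\<close>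
    define s where "s i j = sqrt (real l * real (a i j))" for i j
    define b :: "nat \<times> nat \<times> nat \<Rightarrow> nat \<Rightarrow> real"
      where "b = (\<lambda>(i, j, x) c. Q (i - 1) (j - 1) c / s i j)"
    have s: "s i j \<noteq> 0" "s i j * s i j = real l * real (a i j)" if "i \<in> {1..l}" "j \<in> {1..k}" for i j
      using assms(1,3) that by (auto simp: s_def)
    show ?thesis
    proof (rule achieves_bipartition_if_representation[OF fin _ card_V])
      fix c c' assume c: "c < k" "c' < k"
      have "(\<Sum>v\<in>pverts G. b v c * b v c') =
          (\<Sum>i\<in>{1..l}. \<Sum>j\<in>{1..k}. Q (i - 1) (j - 1) c * Q (i - 1) (j - 1) c' / l)"
        unfolding sum_V using assms(3) by (intro sum.cong) (auto simp: b_def s)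
      also have "\<dots> = (\<Sum>i<l. \<Sum>j<k. Q i j c * Q i j c' / l)"
        by (simp add: sum.atLeast1_atMost_eq)
      also have "\<dots> = (\<Sum>i<l. of_bool (c = c') / l)"
        using Q c by (intro sum.cong) (auto simp: orthogonal_entries_def simp flip: sum_divide_distrib)
      also have "\<dots> = of_bool (c = c')" using assms(1) by simp
      finally show "(\<Sum>v\<in>pverts G. b v c * b v c') = of_bool (c = c')" .
    next
      fix u v assume uv: "u \<in> pverts G" "v \<in> pverts G" "u \<noteq> v"
      obtain i j x i' j' x' where u: "u = (i, j, x)" and v: "v = (i', j', x')"
        by (metis prod.exhaust)
      have range: "i \<in> {1..l}" "j \<in> {1..k}" "i' \<in> {1..l}" "j' \<in> {1..k}"
        using uv by (auto simp: u v V)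
      have "(\<Sum>c<k. b u c * b v c) = (\<Sum>c<k. Q (i - 1) (j - 1) c * Q (i' - 1) (j' - 1) c) / (s i j * s i' j')"
        by (simp add: b_def u v sum_divide_distrib)
      \<comment> \<open>Inside a factor, orthonormal rows give 1 for the same clique and 0 for
        different ones; across factors the general position of the matrices applies.\<close>
      moreover have "(\<Sum>c<k. Q (i - 1) (j - 1) c * Q (i' - 1) (j' - 1) c) \<noteq> 0 \<longleftrightarrow> i \<noteq> i' \<or> j = j'"
      proof (cases "i = i'")
        case True
        have "i - 1 < l" "j - 1 < k" "j' - 1 < k" using range by auto
        then have "(\<Sum>c<k. Q (i - 1) (j - 1) c * Q (i - 1) (j' - 1) c) = of_bool (j - 1 = j' - 1)"
          using Q by (simp add: orthogonal_entries_def)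
        then show ?thesis using True range by auto
      next
        case False
        have "i - 1 < l" "j - 1 < k" "i' - 1 < l" "j' - 1 < k" "i - 1 \<noteq> i' - 1" using range False by auto
        then show ?thesis using False Q' by blast
      qed
      ultimately show "(\<Sum>c<k. b u c * b v c) \<noteq> 0 \<longleftrightarrow> (u, v) \<in> parcs G"
        using s range uv arc by (auto simp: u v)
    qed (use assms(2) in simp)
  qed
  have mem: "(1, j, 0) \<in> pverts G" if "j \<in> {1..k}" for j
    using assms(1,3) that by (auto simp: V)
  have nbr: "\<exists>v\<in>pverts G. v \<noteq> (1, j, 0) \<and> ((1, j, 0), v) \<in> parcs G" if j: "j \<in> {1..k}" for j
  \<comment> \<open>A neighbour is a second vertex of the same clique if there is one factor, and a
    vertex of the second factor otherwise.\<close>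
  proof (cases "l = 1")
    case True
    then have v: "(1, j, 1) \<in> pverts G" using assms(4) j by (auto simp: V Suc_le_eq numeral_2_eq_2)
    show ?thesis using arc[OF mem[OF j] v] v by (intro bexI[of _ "(1, j, 1)"]) simp_all
  next
    case False
    then have v: "(2, 1, 0) \<in> pverts G" using assms(1-3) by (auto simp: V)
    show ?thesis using arc[OF mem[OF j] v] v by (intro bexI[of _ "(2, 1, 0)"]) simp_all
  qed
  have least: "k \<le> m" if "achieves_bipartition G m" for m
  proof -
    let ?U = "(\<lambda>j. (1, j, 0)) ` {1..k} :: (nat \<times> nat \<times> nat) set"
    have "card ?U \<le> m"
    proof (rule card_independent_le[OF that])
      fix u v assume "u \<in> ?U" "v \<in> ?U"
      then show "(u, v) \<notin> parcs G" using arc[OF mem mem] by blast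
    qed (use mem nbr in blast)+
    moreover have "card ?U = k" by (simp add: card_image inj_on_def)
    ultimately show ?thesis by simp
  qed
  have "MB G = k"
    unfolding MB_def using achieved least by (rule Least_equality)
  moreover have "q G = 2"
    unfolding q_def
  proof (rule Least_equality)
    show "\<exists>A\<in>\<S> G. q_mat A = 2"
      using achieved by (auto simp: achieves_bipartition_def q_mat_def card_2_iff)
  next
    fix d assume "\<exists>A\<in>\<S> G. q_mat A = d"
    then obtain A where A: "A \<in> \<S> G" "q_mat A = d" by blast
    have 1: "1 \<in> {1..k}" using assms(2) by simp
    then obtain v where "v \<in> pverts G" "v \<noteq> (1, 1, 0)" "((1, 1, 0), v) \<in> parcs G"
      using nbr by blast
    then show "2 \<le> d"
      using graph_matrix_spectrum_card_ge_2[OF A(1)] mem[OF 1] A(2) by metis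
  qed
  ultimately show ?thesis by blast
qed

end
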